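(* Let $R,C$ be positive integers, ${\cal I}=\{(i,j)\mid 1\le i\le R,\ 1\le j\le C\}$ and let $S$ be a nonempty proper subset of ${\cal I}$. Then ${\cal B}_0(S)$ is a Markov basis for $S$ if and only if neither $S$ nor its complement $S^c={\cal I}\setminus S$ contains the pattern ${\cal P}$ or the pattern ${\cal P}^t$ (in the sense defined in the context).
   Context: A table is an array $X=(x_{ij})_{(i,j)\in{\cal I}}$ with entries in $\mathbb{N}=\{0,1,2,\dots\}$; write $x_{i+}=\sum_j x_{ij}$, $x_{+j}=\sum_i x_{ij}$ and $x(S)=\sum_{(i,j)\in S}x_{ij}$. The fiber of a table $X$ is the set of all tables $Y$ with $y_{i+}=x_{i+}$ for all $i$, $y_{+j}=x_{+j}$ for all $j$, and $y(S)=x(S)$. A move for $S$ is an integer array $B=(b_{ij})_{(i,j)\in{\cal I}}$ all of whose row sums and column sums are $0$ and with $\sum_{(i,j)\in S}b_{ij}=0$. A Markov basis for $S$ is a finite set ${\cal B}$ of moves for $S$, closed under $B\mapsto -B$, such that for every fiber ${\cal F}$ and every $X,Y\in{\cal F}$ there exist $\alpha\ge 1$ and $B_1,\dots,B_\alpha\in{\cal B}$ with $Y=X+\sum_{s=1}^{\alpha}B_s$ and $X+\sum_{s=1}^{a}B_s\in{\cal F}$ for all $1\le a\le\alpha$. For $i\ne i'$ and $j\ne j'$ the basic move $B(i,i';j,j')$ is the array with $+1$ at $(i,j)$ and $(i',j')$, $-1$ at $(i,j')$ and $(i',j)$, and $0$ elsewhere. ${\cal B}_0(S)$ denotes the set of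 all basic moves that are moves for $S$. For $T\in\{S,S^c\}$: $T$ contains the pattern ${\cal P}$ if there exist distinct rows $i_1,i_2$ and distinct columns $j_1,j_2,j_3$ such that $(i_1,j_1),(i_2,j_2)\in T$ and $(i_1,j_2),(i_2,j_1),(i_1,j_3),(i_2,j_3)\notin T$; $T$ contains the pattern ${\cal P}^t$ if there exist distinct rows $i_1,i_2,i_3$ and distinct columns $j_1,j_2$ such that $(i_1,j_1),(i_2,j_2)\in T$ and $(i_1,j_2),(i_2,j_1),(i_3,j_1),(i_3,j_2)\notin T$.
   Formalization: In the definition of a Markov basis, the connecting path with α ≥ 1 is required only for distinct X, Y in a fiber; for X = Y = 0 the literal definition would need the zero move, which is never in B_0(S). *)

theory Defs
  imports Main
begin

definition cells :: "nat \<Rightarrow> nat \<Rightarrow> (nat \<times> nat) set" where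
  "cells R C = {1..R} \<times> {1..C}"

text \<open>
  An integer array indexed by \<^term>\<open>cells R C\<close> is a function that vanishes outside of it,
  so that equality of functions is equality of arrays.
\<close>
type_synonym array = "nat \<times> nat \<Rightarrow> int"

definition is_array :: "nat \<Rightarrow> nat \<Rightarrow> array \<Rightarrow> bool" where
  "is_array R C B \<longleftrightarrow> (\<forall>p. p \<notin> cells R C \<longrightarrow> B p = 0)"

definition row_sum :: "nat \<Rightarrow> array \<Rightarrow> nat \<Rightarrow> int" where
  "row_sum C B i = (\<Sum>j=1..C. B (i, j))"

definition col_sum :: "nat \<Rightarrow> array \<Rightarrow> nat \<Rightarrow> int" where
  "col_sum R B j = (\<Sum>i=1..R. B (i, j))"

text \<open>Tables are integer valued so that moves can be added to them directly.\<close>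
definition is_table :: "nat \<Rightarrow> nat \<Rightarrow> array \<Rightarrow> bool" where
  "is_table R C X \<longleftrightarrow> is_array R C X \<and> (\<forall>p. X p \<in> \<nat>)"

definition fiber :: "nat \<Rightarrow> nat \<Rightarrow> (nat \<times> nat) set \<Rightarrow> array \<Rightarrow> array set" where
  "fiber R C S X = {Y. is_table R C Y \<and>
     (\<forall>i\<in>{1..R}. row_sum C Y i = row_sum C X i) \<and>
     (\<forall>j\<in>{1..C}. col_sum R Y j = col_sum R X j) \<and>
     sum Y S = sum X S}"

definition is_move :: "nat \<Rightarrow> nat \<Rightarrow> (nat \<times> nat) set \<Rightarrow> array \<Rightarrow> bool" where
  "is_move R C S B \<longleftrightarrow> is_array R C B \<and>
     (\<forall>i\<in>{1..R}. row_sum C B i = 0) \<and>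
     (\<forall>j\<in>{1..C}. col_sum R B j = 0) \<and>
     sum B S = 0"

text \<open>
  The connecting path has length \<open>\<alpha> \<ge> 1\<close> and is required for distinct \<open>X\<close>, \<open>Y\<close> only: for
  \<open>X = Y\<close> in a one-element fiber (such as that of the zero table) a nonempty path would have
  to use the zero move, so no set of nonzero moves could be a Markov basis.
\<close>
definition markov_basis :: "nat \<Rightarrow> nat \<Rightarrow> (nat \<times> nat) set \<Rightarrow> array set \<Rightarrow> bool" where
  "markov_basis R C S \<B> \<longleftrightarrow>
     finite \<B> \<and>
     (\<forall>B\<in>\<B>. is_move R C S B) \<and>
     (\<forall>B\<in>\<B>. (\<lambda>p. - B p) \<in> \<B>) \<and>
     (\<forall>Z. is_table R C Z \<longrightarrow>
       (\<forall>X\<in>fiber R C S Z. \<forall>Y\<in>fiber R C S Z. X \<noteq> Y \<longrightarrow>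
         (\<exists>\<alpha>\<ge>1. \<exists>M :: nat \<Rightarrow> array.
            (\<forall>s\<in>{1..\<alpha>}. M s \<in> \<B>) \<and>
            Y = (\<lambda>p. X p + (\<Sum>s=1..\<alpha>. M s p)) \<and>
            (\<forall>a\<in>{1..\<alpha>}. (\<lambda>p. X p + (\<Sum>s=1..a. M s p)) \<in> fiber R C S Z))))"

definition basic_move :: "nat \<Rightarrow> nat \<Rightarrow> nat \<Rightarrow> nat \<Rightarrow> array" where
  "basic_move i i' j j' =
     (\<lambda>p. if p = (i, j) \<or> p = (i', j') then 1
          else if p = (i, j') \<or> p = (i', j) then - 1
          else 0)"

definition basic_moves :: "nat \<Rightarrow> nat \<Rightarrow> (nat \<times> nat) set \<Rightarrow> array set" where
  "basic_moves R C S = {basic_move i i' j j' | i i' j j'.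
     i \<in> {1..R} \<and> i' \<in> {1..R} \<and> i \<noteq> i' \<and>
     j \<in> {1..C} \<and> j' \<in> {1..C} \<and> j \<noteq> j' \<and>
     is_move R C S (basic_move i i' j j')}"

definition contains_P :: "nat \<Rightarrow> nat \<Rightarrow> (nat \<times> nat) set \<Rightarrow> bool" where
  "contains_P R C T \<longleftrightarrow>
     (\<exists>i1\<in>{1..R}. \<exists>i2\<in>{1..R}. \<exists>j1\<in>{1..C}. \<exists>j2\<in>{1..C}. \<exists>j3\<in>{1..C}.
        i1 \<noteq> i2 \<and> j1 \<noteq> j2 \<and> j1 \<noteq> j3 \<and> j2 \<noteq> j3 \<and>
        (i1, j1) \<in> T \<and> (i2, j2) \<in> T \<and>
        (i1, j2) \<notin> T \<and> (i2, j1) \<notin> T \<and> (i1, j3) \<notin> T \<and> (i2, j3) \<notin> T)"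

definition contains_Pt :: "nat \<Rightarrow> nat \<Rightarrow> (nat \<times> nat) set \<Rightarrow> bool" where
  "contains_Pt R C T \<longleftrightarrow>
     (\<exists>i1\<in>{1..R}. \<exists>i2\<in>{1..R}. \<exists>i3\<in>{1..R}. \<exists>j1\<in>{1..C}. \<exists>j2\<in>{1..C}.
        i1 \<noteq> i2 \<and> i1 \<noteq> i3 \<and> i2 \<noteq> i3 \<and> j1 \<noteq> j2 \<and>
        (i1, j1) \<in> T \<and> (i2, j2) \<in> T \<and>
        (i1, j2) \<notin> T \<and> (i2, j1) \<notin> T \<and> (i3, j1) \<notin> T \<and> (i3, j2) \<notin> T)"

end

theory Submission
  imports Defs
begin

text \<open>
  Each pattern yields a table with entries 1, 1, 2 whose fiber has a second element, while no
  applicable basic move preserves the sum over \<open>S\<close>. Conversely, a pattern-free \<open>S\<close> has either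
  its rows totally ordered by inclusion, or the form \<open>I \<times> J \<union> I\<^sup>c \<times> J\<^sup>c\<close>. In the second case the
  margins determine the sum over \<open>S\<close> from the sum over \<open>I \<times> J\<close> and vice versa, so \<open>S\<close> may be
  replaced by \<open>I \<times> J\<close>, which is of the first kind. In the first case, put rows and columns on a
  circle so that row \<open>i\<close> precedes column \<open>j\<close> iff \<open>(i, j) \<in> S\<close>, and read a table as a multiset
  of clockwise arcs from rows to columns. The sum over \<open>S\<close> fixes the total winding, hence how many
  arcs cover each point. Replacing two nested arcs by two crossing ones is an
  admissible basic move and lowers the sum of squared lengths, so every table is connected to one
  without nested arcs, and a fiber contains only one such table.
\<close>

section \<open>Basic moves and fibers\<close>

lemma finite_cells: "finite (cells R C)"
  by (simp add: cells_def)

text \<open>The weight \<open>f\<close> has two uses: constantly 1, it yields the sums over rows,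
  columns and \<open>S\<close>; as the squared arc length, it yields the change in
  \<open>energy\<close>.\<close>

lemma sum_basic_move_mult:
  assumes "finite T" "i \<noteq> i'" "j \<noteq> j'"
  shows "(\<Sum>p\<in>T. basic_move i i' j j' p * f p) =
    (if (i, j) \<in> T then f (i, j) else 0) + (if (i', j') \<in> T then f (i', j') else 0)
    - (if (i, j') \<in> T then f (i, j') else 0) - (if (i', j) \<in> T then f (i', j) else 0)"
proof -
  have "(\<Sum>p\<in>T. basic_move i i' j j' p * f p) =
    (\<Sum>p\<in>T. (if p = (i, j) then f p else 0) + (if p = (i', j') then f p else 0)
      - (if p = (i, j') then f p else 0) - (if p = (i', j) then f p else 0))"
    using assms by (intro sum.cong) (auto simp: basic_move_def)
  also have "\<dots> = (if (i, j) \<in> T then f (i, j) else 0) + (if (i', j') \<in> T then f (i', j') else 0)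
    - (if (i, j') \<in> T then f (i, j') else 0) - (if (i', j) \<in> T then f (i', j) else 0)"
    using assms(1) by (simp add: sum.distrib sum_subtractf sum.delta)
  finally show ?thesis .
qed

lemma sum_basic_move:
  assumes "finite T" "i \<noteq> i'" "j \<noteq> j'"
  shows "sum (basic_move i i' j j') T =
    of_bool ((i, j) \<in> T) + of_bool ((i', j') \<in> T)
    - of_bool ((i, j') \<in> T) - of_bool ((i', j) \<in> T)"
  using sum_basic_move_mult[OF assms, of "\<lambda>_. 1"] by (simp add: of_bool_def)

lemma row_sum_eq: "row_sum C X i = sum X ({i} \<times> {1..C})"
  unfolding row_sum_def
  by (rule sum.reindex_bij_witness[of _ snd "Pair i"]) auto

lemma col_sum_eq: "col_sum R X j = sum X ({1..R} \<times> {j})"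
  unfolding col_sum_def
  by (rule sum.reindex_bij_witness[of _ fst "\<lambda>i. (i, j)"]) auto

lemma row_sum_basic_move:
  assumes "i \<noteq> i'" "j \<noteq> j'" "j \<in> {1..C}" "j' \<in> {1..C}"
  shows "row_sum C (basic_move i i' j j') k = 0"
  unfolding row_sum_eq using assms by (subst sum_basic_move) auto

lemma col_sum_basic_move:
  assumes "i \<noteq> i'" "j \<noteq> j'" "i \<in> {1..R}" "i' \<in> {1..R}"
  shows "col_sum R (basic_move i i' j j') k = 0"
  unfolding col_sum_eq using assms by (subst sum_basic_move) auto

lemma row_sum_add: "row_sum C (\<lambda>p. X p + Y p) i = row_sum C X i + row_sum C Y i"
  by (simp add: row_sum_def sum.distrib)

lemma col_sum_add: "col_sum R (\<lambda>p. X p + Y p) i = col_sum R X i + col_sum R Y i"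
  by (simp add: col_sum_def sum.distrib)

lemma is_array_basic_move:
  assumes "i \<in> {1..R}" "i' \<in> {1..R}" "j \<in> {1..C}" "j' \<in> {1..C}"
  shows "is_array R C (basic_move i i' j j')"
  using assms by (auto simp: is_array_def cells_def basic_move_def)

lemma is_array_add: "is_array R C X \<Longrightarrow> is_array R C Y \<Longrightarrow> is_array R C (\<lambda>p. X p + Y p)"
  by (simp add: is_array_def)

lemma is_move_basic_move_iff:
  assumes "i \<in> {1..R}" "i' \<in> {1..R}" "j \<in> {1..C}" "j' \<in> {1..C}" "i \<noteq> i'" "j \<noteq> j'"
  shows "is_move R C S (basic_move i i' j j') \<longleftrightarrow> sum (basic_move i i' j j') S = 0"
  using assms
  by (simp add: is_move_def is_array_basic_move row_sum_basic_move col_sum_basic_move)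

lemma basic_move_uminus: "i \<noteq> i' \<Longrightarrow> j \<noteq> j' \<Longrightarrow> (\<lambda>p. - basic_move i i' j j' p) = basic_move i i' j' j"
  by (auto simp: basic_move_def fun_eq_iff)

lemma finite_basic_moves: "finite (basic_moves R C S)"
proof (rule finite_subset)
  show "basic_moves R C S \<subseteq>
    (\<lambda>(i, i', j, j'). basic_move i i' j j') ` ({1..R} \<times> {1..R} \<times> {1..C} \<times> {1..C})"
    by (force simp: basic_moves_def)
qed simp

lemma is_move_uminus: "is_move R C S B \<Longrightarrow> is_move R C S (\<lambda>p. - B p)"
  by (simp add: is_move_def is_array_def row_sum_def col_sum_def sum_negf)

lemma uminus_basic_moves: "B \<in> basic_moves R C S \<Longrightarrow> (\<lambda>p. - B p) \<in> basic_moves R C S"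
proof -
  assume "B \<in> basic_moves R C S"
  then obtain i i' j j' where B: "i \<in> {1..R}" "i' \<in> {1..R}" "i \<noteq> i'"
    "j \<in> {1..C}" "j' \<in> {1..C}" "j \<noteq> j'" "is_move R C S B" "B = basic_move i i' j j'"
    unfolding basic_moves_def by blast
  then have "(\<lambda>p. - B p) = basic_move i i' j' j"
    by (simp add: basic_move_uminus)
  moreover have "is_move R C S (\<lambda>p. - B p)"
    using B(7) by (rule is_move_uminus)
  ultimately show ?thesis
    unfolding basic_moves_def using B by auto
qed

section \<open>Walks of tables inside a fiber\<close>

lemma is_table_iff: "is_table R C X \<longleftrightarrow> is_array R C X \<and> (\<forall>p. 0 \<le> X p)"
  by (auto simp: is_table_def Nats_altdef1)

lemma is_table_nonneg: "is_table R C X \<Longrightarrow> 0 \<le> X p"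
  unfolding is_table_iff by blast

lemma fiber_add_move:
  assumes "X \<in> fiber R C S Z" "is_move R C S B" "is_table R C (\<lambda>p. X p + B p)"
  shows "(\<lambda>p. X p + B p) \<in> fiber R C S Z"
  using assms by (simp add: fiber_def is_move_def row_sum_add col_sum_add sum.distrib)

text \<open>Requiring a table at both ends makes the relation symmetric and confines a chain of
  swaps to one fiber.\<close>

definition swap :: "nat \<Rightarrow> nat \<Rightarrow> (nat \<times> nat) set \<Rightarrow> array \<Rightarrow> array \<Rightarrow> bool" where
  "swap R C S X Y \<longleftrightarrow> is_table R C X \<and> is_table R C Y \<and>
     (\<exists>B\<in>basic_moves R C S. Y = (\<lambda>p. X p + B p))"

lemma swap_sym: "swap R C S X Y \<Longrightarrow> swap R C S Y X"
proof -
  assume *: "swap R C S X Y"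
  then obtain B where "B \<in> basic_moves R C S" "Y = (\<lambda>p. X p + B p)"
    by (auto simp: swap_def)
  then show ?thesis
    using * uminus_basic_moves[of B R C S]
    by (auto simp: swap_def intro!: bexI[of _ "\<lambda>p. - B p"])
qed

lemma swaps_sym: "(swap R C S)\<^sup>*\<^sup>* X Y \<Longrightarrow> (swap R C S)\<^sup>*\<^sup>* Y X"
  by (induction rule: rtranclp_induct) (auto intro: swap_sym converse_rtranclp_into_rtranclp)

lemma swap_fiber: "swap R C S X Y \<Longrightarrow> X \<in> fiber R C S Z \<Longrightarrow> Y \<in> fiber R C S Z"
  by (auto simp: swap_def basic_moves_def intro: fiber_add_move)

lemma swaps_fiber: "(swap R C S)\<^sup>*\<^sup>* X Y \<Longrightarrow> X \<in> fiber R C S Z \<Longrightarrow> Y \<in> fiber R C S Z"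
  by (induction rule: rtranclp_induct) (auto intro: swap_fiber)

lemma swaps_path:
  assumes "(swap R C S)\<^sup>*\<^sup>* X Y" "X \<in> fiber R C S Z"
  shows "\<exists>\<alpha>. \<exists>M :: nat \<Rightarrow> array. (\<forall>s\<in>{1..\<alpha>}. M s \<in> basic_moves R C S) \<and>
    Y = (\<lambda>p. X p + (\<Sum>s=1..\<alpha>. M s p)) \<and>
    (\<forall>a\<in>{1..\<alpha>}. (\<lambda>p. X p + (\<Sum>s=1..a. M s p)) \<in> fiber R C S Z)"
  using assms(1)
proof (induction rule: rtranclp_induct)
  case base
  \<comment> \<open>The empty walk is allowed here; \<open>markov_basisI\<close> recovers
    \<open>\<alpha> \<ge> 1\<close> from \<open>X \<noteq> Y\<close>.\<close>
  show ?case by (intro exI[of _ 0]) auto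
next
  case (step Y W)
  from step.IH obtain \<alpha> and M :: "nat \<Rightarrow> array" where M:
    "\<forall>s\<in>{1..\<alpha>}. M s \<in> basic_moves R C S"
    "Y = (\<lambda>p. X p + (\<Sum>s=1..\<alpha>. M s p))"
    "\<forall>a\<in>{1..\<alpha>}. (\<lambda>p. X p + (\<Sum>s=1..a. M s p)) \<in> fiber R C S Z"
    by (elim exE conjE)
  obtain B where B: "B \<in> basic_moves R C S" "W = (\<lambda>p. Y p + B p)"
    using step(2) by (auto simp: swap_def)
  have W: "W \<in> fiber R C S Z"
    using step(1,2) assms(2) by (meson swap_fiber swaps_fiber)
  \<comment> \<open>The new step is stored at position \<open>Suc \<alpha>\<close>, where the
    partial sums up to \<open>\<alpha>\<close> do not see it.\<close>
  define N where "N = M(Suc \<alpha> := B)"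
  have eq: "(\<Sum>s=1..a. N s p) = (\<Sum>s=1..a. M s p)" if "a \<le> \<alpha>" for a p
    using that by (intro sum.cong) (auto simp: N_def)
  have W_eq: "W = (\<lambda>p. X p + (\<Sum>s=1..Suc \<alpha>. N s p))"
    using B M(2) eq[of \<alpha>] by (simp add: N_def add.assoc)
  show ?case
  proof (intro exI conjI ballI)
    show "N s \<in> basic_moves R C S" if "s \<in> {1..Suc \<alpha>}" for s
      using that M(1) B(1) by (auto simp: N_def le_Suc_eq)
    show "(\<lambda>p. X p + (\<Sum>s=1..a. N s p)) \<in> fiber R C S Z" if "a \<in> {1..Suc \<alpha>}" for a
    proof (cases "a \<le> \<alpha>")
      case True
      then show ?thesis using that M(3) eq[OF True] by simp
    next
      case False
      then have "a = Suc \<alpha>" using that by simp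
      then show ?thesis using W W_eq by simp
    qed
  qed (fact W_eq)
qed

lemma markov_basisI:
  assumes "\<And>X Y. is_table R C X \<Longrightarrow> Y \<in> fiber R C S X \<Longrightarrow> (swap R C S)\<^sup>*\<^sup>* X Y"
  shows "markov_basis R C S (basic_moves R C S)"
  unfolding markov_basis_def
proof (intro conjI ballI allI impI)
  fix Z X Y
  assume *: "X \<in> fiber R C S Z" "Y \<in> fiber R C S Z" "X \<noteq> Y"
  then have "is_table R C X" "Y \<in> fiber R C S X"
    by (auto simp: fiber_def)
  then have "(swap R C S)\<^sup>*\<^sup>* X Y" by (rule assms)
  from swaps_path[OF this *(1)] obtain \<alpha> and M :: "nat \<Rightarrow> array" where M:
    "\<forall>s\<in>{1..\<alpha>}. M s \<in> basic_moves R C S"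
    "Y = (\<lambda>p. X p + (\<Sum>s=1..\<alpha>. M s p))"
    "\<forall>a\<in>{1..\<alpha>}. (\<lambda>p. X p + (\<Sum>s=1..a. M s p)) \<in> fiber R C S Z"
    by (elim exE conjE)
  have "\<alpha> \<ge> 1"
    using M(2) *(3) by (cases \<alpha>) auto
  with M show "\<exists>\<alpha>\<ge>1. \<exists>M :: nat \<Rightarrow> array. (\<forall>s\<in>{1..\<alpha>}. M s \<in> basic_moves R C S) \<and>
    Y = (\<lambda>p. X p + (\<Sum>s=1..\<alpha>. M s p)) \<and>
    (\<forall>a\<in>{1..\<alpha>}. (\<lambda>p. X p + (\<Sum>s=1..a. M s p)) \<in> fiber R C S Z)"
    by blast
qed (auto simp: finite_basic_moves uminus_basic_moves, auto simp: basic_moves_def)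

section \<open>Sets with equivalent sum constraints\<close>

definition same_margins :: "nat \<Rightarrow> nat \<Rightarrow> array \<Rightarrow> array \<Rightarrow> bool" where
  "same_margins R C X Y \<longleftrightarrow>
     (\<forall>i\<in>{1..R}. row_sum C X i = row_sum C Y i) \<and> (\<forall>j\<in>{1..C}. col_sum R X j = col_sum R Y j)"

text \<open>Fibers and moves depend on the set only through the question whether two arrays with
  equal margins have equal sums over it. For moves, one of the two arrays is zero.\<close>

lemma markov_basis_basic_moves_cong:
  assumes "\<And>X Y. same_margins R C X Y \<Longrightarrow> sum X S = sum Y S \<longleftrightarrow> sum X T = sum Y T"
  shows "markov_basis R C S (basic_moves R C S) \<longleftrightarrow> markov_basis R C T (basic_moves R C T)"
proof -
  have fiber: "fiber R C S = fiber R C T"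
    using assms unfolding fiber_def same_margins_def fun_eq_iff by blast
  have move: "is_move R C S = is_move R C T"
  proof
    fix B
    show "is_move R C S B = is_move R C T B"
      using assms[of B "\<lambda>_. 0"]
      by (auto simp: is_move_def same_margins_def row_sum_def col_sum_def)
  qed
  show ?thesis
    unfolding markov_basis_def basic_moves_def fiber move ..
qed

lemma sum_rows: "sum X (A \<times> {1..C}) = (\<Sum>i\<in>A. row_sum C X i)"
  by (simp add: row_sum_def sum.cartesian_product)

lemma sum_cols: "sum X ({1..R} \<times> B) = (\<Sum>j\<in>B. col_sum R X j)"
  unfolding col_sum_def by (subst sum.swap) (simp add: sum.cartesian_product)

text \<open>The row sums fix the total over all cells, so fixing the sum over \<open>S\<close> fixes
  the sum over the complement. This lets a pattern in the complement obstruct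
  \<open>S\<close>.\<close>

lemma markov_basis_complement:
  assumes "S \<subseteq> cells R C"
  shows "markov_basis R C (cells R C - S) (basic_moves R C (cells R C - S)) \<longleftrightarrow>
    markov_basis R C S (basic_moves R C S)"
proof (rule markov_basis_basic_moves_cong)
  fix X Y
  assume "same_margins R C X Y"
  then have "sum X (cells R C) = sum Y (cells R C)"
    unfolding cells_def sum_rows same_margins_def by simp
  moreover have "sum W (cells R C) = sum W S + sum W (cells R C - S)" for W :: array
    using assms finite_cells by (metis add.commute sum.subset_diff)
  ultimately show "sum X (cells R C - S) = sum Y (cells R C - S) \<longleftrightarrow> sum X S = sum Y S"
    by (metis add_left_imp_eq add_right_imp_eq)
qed

text \<open>The second block consists of the rows outside \<open>I\<close>, minus the columns in
  \<open>J\<close>, plus \<open>I \<times> J\<close>. So the sum over \<open>S\<close> is twice that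
  over \<open>I \<times> J\<close> plus a quantity fixed by the margins, and the factor 2
  cancels.\<close>

lemma markov_basis_two_blocks:
  assumes "I \<subseteq> {1..R}" "J \<subseteq> {1..C}"
  defines "S \<equiv> I \<times> J \<union> ({1..R} - I) \<times> ({1..C} - J)"
  shows "markov_basis R C S (basic_moves R C S) \<longleftrightarrow>
    markov_basis R C (I \<times> J) (basic_moves R C (I \<times> J))"
proof (rule markov_basis_basic_moves_cong)
  fix X Y
  assume XY: "same_margins R C X Y"
  have fin: "finite I" "finite J" using assms finite_subset by blast+
  have S: "sum W S = 2 * sum W (I \<times> J) + (\<Sum>i\<in>{1..R} - I. row_sum C W i) - (\<Sum>j\<in>J. col_sum R W j)"
    for W :: array
  proof -
    have "sum W S = sum W (I \<times> J) + sum W (({1..R} - I) \<times> ({1..C} - J))"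
      unfolding S_def using fin by (intro sum.union_disjoint) auto
    moreover have "sum W (({1..R} - I) \<times> {1..C}) =
      sum W (({1..R} - I) \<times> J) + sum W (({1..R} - I) \<times> ({1..C} - J))"
      using fin assms by (subst sum.union_disjoint[symmetric]) (auto intro!: arg_cong[of _ _ "sum W"])
    moreover have "sum W ({1..R} \<times> J) = sum W (I \<times> J) + sum W (({1..R} - I) \<times> J)"
      using fin assms by (subst sum.union_disjoint[symmetric]) (auto intro!: arg_cong[of _ _ "sum W"])
    ultimately show ?thesis unfolding sum_rows sum_cols by simp
  qed
  have "(\<Sum>i\<in>{1..R} - I. row_sum C X i) = (\<Sum>i\<in>{1..R} - I. row_sum C Y i)"
    "(\<Sum>j\<in>J. col_sum R X j) = (\<Sum>j\<in>J. col_sum R Y j)"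
    using XY assms by (auto simp: same_margins_def intro!: sum.cong)
  then show "sum X S = sum Y S \<longleftrightarrow> sum X (I \<times> J) = sum Y (I \<times> J)"
    unfolding S by simp
qed

section \<open>The patterns obstruct connectivity\<close>

text \<open>A path from \<open>X\<close> to \<open>Y\<close> starts with a basic move, which
  subtracts 1 in two cells; both must be positive in \<open>X\<close> for the first intermediate
  array to be a table. The premise \<open>stuck\<close> rules this out.\<close>

lemma not_markov_basisI:
  assumes X: "is_table R C X" and Y: "Y \<in> fiber R C S X" "Y \<noteq> X"
    and stuck: "\<And>i i' j j'. i \<noteq> i' \<Longrightarrow> j \<noteq> j' \<Longrightarrow> is_move R C S (basic_move i i' j j') \<Longrightarrow>
      X (i, j') > 0 \<Longrightarrow> X (i', j) > 0 \<Longrightarrow> False"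
  shows "\<not> markov_basis R C S (basic_moves R C S)"
proof
  assume mb: "markov_basis R C S (basic_moves R C S)"
  have XX: "X \<in> fiber R C S X"
    using X by (simp add: fiber_def)
  obtain \<alpha> and M :: "nat \<Rightarrow> array" where "\<alpha> \<ge> 1"
    "\<forall>s\<in>{1..\<alpha>}. M s \<in> basic_moves R C S"
    "\<forall>a\<in>{1..\<alpha>}. (\<lambda>p. X p + (\<Sum>s=1..a. M s p)) \<in> fiber R C S X"
    using mb[unfolded markov_basis_def, THEN conjunct2, THEN conjunct2, THEN conjunct2,
        THEN spec, THEN mp, THEN bspec, THEN bspec, THEN mp, OF X XX Y(1) Y(2)[symmetric]]
    by (elim exE conjE)
  then have M: "M 1 \<in> basic_moves R C S" "(\<lambda>p. X p + (\<Sum>s=1..1. M s p)) \<in> fiber R C S X"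
    by (meson atLeastAtMost_iff le_refl)+
  then obtain i i' j j' where *: "i \<noteq> i'" "j \<noteq> j'" "is_move R C S (basic_move i i' j j')"
    "M 1 = basic_move i i' j j'"
    unfolding basic_moves_def by auto
  have nonneg: "0 \<le> X p + basic_move i i' j j' p" for p
    using M(2) *(4) is_table_nonneg[of R C "\<lambda>p. X p + M 1 p" p] by (simp add: fiber_def)
  have "X (i, j') > 0" "X (i', j) > 0"
    using nonneg[of "(i, j')"] nonneg[of "(i', j)"] *(1,2) by (auto simp: basic_move_def)
  with stuck * show False by blast
qed

text \<open>\<open>Y\<close> arises from \<open>X\<close> by exchanging rows \<open>i1\<close> and
  \<open>i2\<close>. Both have sum 1 over \<open>S\<close>, from \<open>(i1, j1)\<close> and
  \<open>(i2, j2)\<close> respectively. The two basic moves composing the exchange change this sum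
  by -1 and by +1, so neither is admissible alone.\<close>

lemma contains_P_not_markov_basis:
  assumes "S \<subseteq> cells R C" "contains_P R C S"
  shows "\<not> markov_basis R C S (basic_moves R C S)"
proof -
  obtain i1 i2 j1 j2 j3 where ran: "i1 \<in> {1..R}" "i2 \<in> {1..R}" "j1 \<in> {1..C}" "j2 \<in> {1..C}" "j3 \<in> {1..C}"
    and ne: "i1 \<noteq> i2" "j1 \<noteq> j2" "j1 \<noteq> j3" "j2 \<noteq> j3"
    and S: "(i1, j1) \<in> S" "(i2, j2) \<in> S" "(i1, j2) \<notin> S" "(i2, j1) \<notin> S" "(i1, j3) \<notin> S" "(i2, j3) \<notin> S"
    using assms(2) unfolding contains_P_def by blast
  have fin: "finite S" using assms(1) finite_cells finite_subset by blast
  define X :: array where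
    "X p = (if p = (i1, j1) \<or> p = (i1, j2) then 1 else if p = (i2, j3) then 2 else 0)" for p
  define Y where "Y p = X p + (basic_move i1 i2 j3 j1 p + basic_move i1 i2 j3 j2 p)" for p
  have X: "is_table R C X"
    using ran by (auto simp: is_table_iff is_array_def cells_def X_def)
  have Y: "Y \<in> fiber R C S X"
    unfolding Y_def
  proof (rule fiber_add_move)
    show "X \<in> fiber R C S X" using X by (simp add: fiber_def)
    show "is_move R C S (\<lambda>p. basic_move i1 i2 j3 j1 p + basic_move i1 i2 j3 j2 p)"
      using ran ne S fin is_array_basic_move[of i1 R i2 j3 C]
      by (simp add: is_move_def is_array_def row_sum_add col_sum_add row_sum_basic_move
          col_sum_basic_move sum.distrib sum_basic_move)
    have "0 \<le> X p + (basic_move i1 i2 j3 j1 p + basic_move i1 i2 j3 j2 p)" for p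
    proof (cases "p = (i1, j1) \<or> p = (i1, j2) \<or> p = (i2, j3)")
      case True
      then show ?thesis
        by (elim disjE) (use ne in \<open>simp_all add: X_def basic_move_def\<close>)
    next
      case False
      then show ?thesis by (simp add: X_def basic_move_def)
    qed
    moreover have "is_array R C (\<lambda>p. X p + (basic_move i1 i2 j3 j1 p + basic_move i1 i2 j3 j2 p))"
      using X ran by (intro is_array_add is_array_basic_move) (simp_all add: is_table_def)
    ultimately show "is_table R C (\<lambda>p. X p + (basic_move i1 i2 j3 j1 p + basic_move i1 i2 j3 j2 p))"
      by (simp add: is_table_iff)
  qed
  have "Y (i1, j1) \<noteq> X (i1, j1)"
    using ne by (simp add: Y_def basic_move_def)
  then have "Y \<noteq> X" by auto
  with X Y show ?thesis
  proof (rule not_markov_basisI)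
    fix i i' j j'
    assume *: "i \<noteq> i'" "j \<noteq> j'" "is_move R C S (basic_move i i' j j')" "X (i, j') > 0" "X (i', j) > 0"
    have "sum (basic_move i i' j j') S = 0"
      using *(3) by (simp add: is_move_def)
    note zero = this[unfolded sum_basic_move[OF fin *(1,2)]]
    have supp: "p = (i1, j1) \<or> p = (i1, j2) \<or> p = (i2, j3)" if "X p > 0" for p
      using that by (auto simp: X_def split: if_splits)
    \<comment> \<open>Two positive cells in different rows and columns must include
      \<open>(i2, j3)\<close>. What remains are, up to the order of indices, the two basic moves
      that build \<open>Y\<close>.\<close>
    have "i = i1 \<and> i' = i2 \<and> j = j3 \<and> (j' = j1 \<or> j' = j2) \<or>
      i = i2 \<and> i' = i1 \<and> j' = j3 \<and> (j = j1 \<or> j = j2)"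
      using supp[OF *(4)] supp[OF *(5)] *(1,2) ne by auto
    then show False
      by (elim disjE conjE) (use zero S in simp_all)
  qed
qed

text \<open>The transposed construction: now \<open>Y\<close> exchanges columns \<open>j1\<close>
  and \<open>j2\<close> of \<open>X\<close>.\<close>

lemma contains_Pt_not_markov_basis:
  assumes "S \<subseteq> cells R C" "contains_Pt R C S"
  shows "\<not> markov_basis R C S (basic_moves R C S)"
proof -
  obtain i1 i2 i3 j1 j2 where ran: "i1 \<in> {1..R}" "i2 \<in> {1..R}" "i3 \<in> {1..R}" "j1 \<in> {1..C}" "j2 \<in> {1..C}"
    and ne: "i1 \<noteq> i2" "i1 \<noteq> i3" "i2 \<noteq> i3" "j1 \<noteq> j2"
    and S: "(i1, j1) \<in> S" "(i2, j2) \<in> S" "(i1, j2) \<notin> S" "(i2, j1) \<notin> S" "(i3, j1) \<notin> S" "(i3, j2) \<notin> S"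
    using assms(2) unfolding contains_Pt_def by blast
  have fin: "finite S" using assms(1) finite_cells finite_subset by blast
  define X :: array where
    "X p = (if p = (i1, j1) \<or> p = (i2, j1) then 1 else if p = (i3, j2) then 2 else 0)" for p
  define Y where "Y p = X p + (basic_move i1 i3 j2 j1 p + basic_move i2 i3 j2 j1 p)" for p
  have X: "is_table R C X"
    using ran by (auto simp: is_table_iff is_array_def cells_def X_def)
  have Y: "Y \<in> fiber R C S X"
    unfolding Y_def
  proof (rule fiber_add_move)
    show "X \<in> fiber R C S X" using X by (simp add: fiber_def)
    show "is_move R C S (\<lambda>p. basic_move i1 i3 j2 j1 p + basic_move i2 i3 j2 j1 p)"
      using ran ne S fin is_array_basic_move[of _ R i3 j2 C j1]
      by (simp add: is_move_def is_array_def row_sum_add col_sum_add row_sum_basic_move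
          col_sum_basic_move sum.distrib sum_basic_move)
    have "0 \<le> X p + (basic_move i1 i3 j2 j1 p + basic_move i2 i3 j2 j1 p)" for p
    proof (cases "p = (i1, j1) \<or> p = (i2, j1) \<or> p = (i3, j2)")
      case True
      then show ?thesis
        by (elim disjE) (use ne in \<open>simp_all add: X_def basic_move_def\<close>)
    next
      case False
      then show ?thesis by (simp add: X_def basic_move_def)
    qed
    moreover have "is_array R C (\<lambda>p. X p + (basic_move i1 i3 j2 j1 p + basic_move i2 i3 j2 j1 p))"
      using X ran by (intro is_array_add is_array_basic_move) (simp_all add: is_table_def)
    ultimately show "is_table R C (\<lambda>p. X p + (basic_move i1 i3 j2 j1 p + basic_move i2 i3 j2 j1 p))"
      by (simp add: is_table_iff)
  qed
  have "Y (i1, j1) \<noteq> X (i1, j1)"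
    using ne by (simp add: Y_def basic_move_def)
  then have "Y \<noteq> X" by auto
  with X Y show ?thesis
  proof (rule not_markov_basisI)
    fix i i' j j'
    assume *: "i \<noteq> i'" "j \<noteq> j'" "is_move R C S (basic_move i i' j j')" "X (i, j') > 0" "X (i', j) > 0"
    have "sum (basic_move i i' j j') S = 0"
      using *(3) by (simp add: is_move_def)
    note zero = this[unfolded sum_basic_move[OF fin *(1,2)]]
    have supp: "p = (i1, j1) \<or> p = (i2, j1) \<or> p = (i3, j2)" if "X p > 0" for p
      using that by (auto simp: X_def split: if_splits)
    have "j' = j1 \<and> j = j2 \<and> i' = i3 \<and> (i = i1 \<or> i = i2) \<or>
      j = j1 \<and> j' = j2 \<and> i = i3 \<and> (i' = i1 \<or> i' = i2)"
      using supp[OF *(4)] supp[OF *(5)] *(1,2) ne by auto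
    then show False
      by (elim disjE conjE) (use zero S in simp_all)
  qed
qed

section \<open>Staircases\<close>

text \<open>Row sets shrink weakly as \<open>u\<close> grows, and column sets grow weakly with
  \<open>v\<close>. Injectivity breaks ties. The values of \<open>u\<close> and of \<open>v\<close>
  are never compared with each other; \<open>L\<close> is the circumference and bounds both.\<close>

locale staircase =
  fixes R C :: nat and S :: "(nat \<times> nat) set" and u v :: "nat \<Rightarrow> nat" and L :: nat
  assumes S_sub: "S \<subseteq> cells R C"
    and u_inj: "inj_on u {1..R}" and v_inj: "inj_on v {1..C}"
    and u_less: "i \<in> {1..R} \<Longrightarrow> u i < L" and v_less: "j \<in> {1..C} \<Longrightarrow> v j < L"
    and u_mono: "i \<in> {1..R} \<Longrightarrow> i' \<in> {1..R} \<Longrightarrow> u i < u i' \<Longrightarrow> (i', j) \<in> S \<Longrightarrow> (i, j) \<in> S"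
    and v_mono: "j \<in> {1..C} \<Longrightarrow> j' \<in> {1..C} \<Longrightarrow> v j < v j' \<Longrightarrow> (i, j) \<in> S \<Longrightarrow> (i, j') \<in> S"
begin

text \<open>As \<open>u\<close> and \<open>v\<close> are independent scales, the value may be
  negative; only differences between arcs matter. Cells outside \<open>S\<close> wrap around once,
  hence \<open>L\<close>.\<close>

definition len :: "nat \<times> nat \<Rightarrow> int" where
  "len p = int (v (snd p)) - int (u (fst p)) + (if p \<in> S then 0 else int L)"

text \<open>
  Place row \<open>i\<close> and column \<open>j\<close> on a circle such that \<open>i\<close> precedes \<open>j\<close> iff \<open>(i, j) \<in> S\<close>.
  A cell is the arc leading clockwise from its row to its column, of length \<^term>\<open>len\<close>,
  and \<open>nested i j i' j'\<close> says that the arc of \<open>(i, j)\<close> contains that of \<open>(i', j')\<close>.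
\<close>
definition nested :: "nat \<Rightarrow> nat \<Rightarrow> nat \<Rightarrow> nat \<Rightarrow> bool" where
  "nested i j i' j' \<longleftrightarrow>
    (if (i, j) \<in> S \<longleftrightarrow> (i', j') \<in> S then u i < u i' \<and> v j' < v j
     else (i, j) \<notin> S \<and> (v j' < v j \<or> u i < u i'))"

definition canonical :: "array \<Rightarrow> bool" where
  "canonical X \<longleftrightarrow> (\<forall>i j i' j'. X (i, j) > 0 \<longrightarrow> X (i', j') > 0 \<longrightarrow> \<not> nested i j i' j')"

definition energy :: "array \<Rightarrow> int" where
  "energy X = (\<Sum>p\<in>cells R C. X p * (len p)\<^sup>2)"

text \<open>Exchanging the endpoints of two nested arcs keeps the number of cells in
  \<open>S\<close>, hence the total length, but brings the two lengths closer together, so the sum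
  of squares drops.\<close>

lemma nested_swap:
  assumes ran: "i \<in> {1..R}" "i' \<in> {1..R}" "j \<in> {1..C}" "j' \<in> {1..C}" and nest: "nested i j i' j'"
  shows "i \<noteq> i'" "j \<noteq> j'" "is_move R C S (basic_move i i' j' j)"
    "(len (i, j'))\<^sup>2 + (len (i', j))\<^sup>2 < (len (i, j))\<^sup>2 + (len (i', j'))\<^sup>2"
proof -
  have fin: "finite S" using S_sub finite_cells finite_subset by blast
  have ST: "(i', j) \<in> S" if "v j' < v j" "(i', j') \<in> S"
    using v_mono ran that by blast
  have NT: "(i, j') \<notin> S" if "v j' < v j" "(i, j) \<notin> S"
    using v_mono ran that by blast
  have ST': "(i, j') \<in> S" if "u i < u i'" "(i', j') \<in> S"
    using u_mono ran that by blast
  have NT': "(i', j) \<notin> S" if "u i < u i'" "(i, j) \<notin> S"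
    using u_mono ran that by blast
  \<comment> \<open>Monotonicity decides whether the two new cells lie in \<open>S\<close>: all four
    cells agree, or each new cell agrees with the old cell in its row (\<open>col\<close>) or in its
    column (\<open>row\<close>).\<close>
  consider
    (same) "u i < u i'" "v j' < v j" "(i, j) \<in> S \<longleftrightarrow> (i', j') \<in> S"
      "(i, j') \<in> S \<longleftrightarrow> (i, j) \<in> S" "(i', j) \<in> S \<longleftrightarrow> (i, j) \<in> S"
    | (col) "v j' < v j" "(i, j) \<notin> S" "(i', j') \<in> S" "(i, j') \<notin> S" "(i', j) \<in> S"
    | (row) "u i < u i'" "(i, j) \<notin> S" "(i', j') \<in> S" "(i, j') \<in> S" "(i', j) \<notin> S"
    using nest ST NT ST' NT' unfolding nested_def by metis
  note cases = this
  show ne: "i \<noteq> i'"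
    using cases by cases auto
  show ne': "j \<noteq> j'"
    using cases by cases auto
  show "is_move R C S (basic_move i i' j' j)"
    using cases ne ne' ran by cases (auto simp: is_move_basic_move_iff sum_basic_move fin)
  \<comment> \<open>These bounds make the factors containing \<open>L\<close> positive in the cases
    \<open>col\<close> and \<open>row\<close>.\<close>
  have L: "u i < L" "v j' < L" using ran u_less v_less by auto
  show "(len (i, j'))\<^sup>2 + (len (i', j))\<^sup>2 < (len (i, j))\<^sup>2 + (len (i', j'))\<^sup>2"
    using cases
  proof cases
    case same
    then have "0 < 2 * ((int (u i') - int (u i)) * (int (v j) - int (v j')))"
      by simp
    also have "\<dots> = (len (i, j))\<^sup>2 + (len (i', j'))\<^sup>2 - ((len (i, j'))\<^sup>2 + (len (i', j))\<^sup>2)"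
      using same by (simp add: len_def power2_eq_square algebra_simps)
    finally show ?thesis by simp
  next
    case col
    then have "0 < 2 * ((int (v j) - int (v j')) * (int L - int (u i) + int (u i')))"
      using L by simp
    also have "\<dots> = (len (i, j))\<^sup>2 + (len (i', j'))\<^sup>2 - ((len (i, j'))\<^sup>2 + (len (i', j))\<^sup>2)"
      using col by (simp add: len_def power2_eq_square algebra_simps)
    finally show ?thesis by simp
  next
    case row
    then have "0 < 2 * ((int (u i') - int (u i)) * (int (v j) + int L - int (v j')))"
      using L by simp
    also have "\<dots> = (len (i, j))\<^sup>2 + (len (i', j'))\<^sup>2 - ((len (i, j'))\<^sup>2 + (len (i', j))\<^sup>2)"
      using row by (simp add: len_def power2_eq_square algebra_simps)
    finally show ?thesis by simp
  qed
qed

section \<open>Descent to canonical tables\<close>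

lemma table_pos_in_range:
  assumes "is_table R C X" "X (i, j) > 0"
  shows "i \<in> {1..R}" "j \<in> {1..C}"
proof -
  have "(i, j) \<in> cells R C"
    using assms by (metis is_array_def is_table_def less_irrefl)
  then show "i \<in> {1..R}" "j \<in> {1..C}" by (simp_all add: cells_def)
qed

lemma swap_decreases_energy:
  assumes X: "is_table R C X" and "\<not> canonical X"
  obtains Y where "swap R C S X Y" "energy Y < energy X"
proof -
  obtain i j i' j' where pos: "X (i, j) > 0" "X (i', j') > 0" and nest: "nested i j i' j'"
    using assms(2) by (auto simp: canonical_def)
  note ran = table_pos_in_range[OF X pos(1)] table_pos_in_range[OF X pos(2)]
  note swap = nested_swap[OF ran(1,3,2,4) nest]
  \<comment> \<open>The order \<open>j' j\<close> makes the move subtract at the two nested cells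
    and add at the crossing ones.\<close>
  define B where "B = basic_move i i' j' j"
  have "is_table R C (\<lambda>p. X p + B p)"
    unfolding is_table_iff
  proof
    show "is_array R C (\<lambda>p. X p + B p)"
      unfolding B_def using X ran
      by (intro is_array_add is_array_basic_move) (simp_all add: is_table_def)
    show "\<forall>p. 0 \<le> X p + B p"
      using pos is_table_nonneg[OF X] by (auto simp: B_def basic_move_def)
  qed
  moreover have "B \<in> basic_moves R C S"
    unfolding basic_moves_def B_def using ran swap by blast
  ultimately have "swap R C S X (\<lambda>p. X p + B p)"
    using X by (auto simp: swap_def)
  moreover have "energy (\<lambda>p. X p + B p) < energy X"
  proof -
    have "energy (\<lambda>p. X p + B p) = energy X + (\<Sum>p\<in>cells R C. B p * (len p)\<^sup>2)"
      by (simp add: energy_def distrib_right sum.distrib)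
    also have "(\<Sum>p\<in>cells R C. B p * (len p)\<^sup>2) =
      (len (i, j'))\<^sup>2 + (len (i', j))\<^sup>2 - (len (i, j))\<^sup>2 - (len (i', j'))\<^sup>2"
      unfolding B_def using ran swap(1,2)
      by (subst sum_basic_move_mult) (auto simp: finite_cells cells_def)
    finally show ?thesis using swap(4) by linarith
  qed
  ultimately show thesis by (rule that)
qed

text \<open>On tables \<open>energy\<close> is a nonnegative integer, so the descent stops.\<close>

lemma swaps_to_canonical:
  assumes "is_table R C X"
  shows "\<exists>W. (swap R C S)\<^sup>*\<^sup>* X W \<and> canonical W"
  using assms
proof (induction "nat (energy X)" arbitrary: X rule: less_induct)
  case less
  show ?case
  proof (cases "canonical X")
    case False
    then obtain Y where Y: "swap R C S X Y" "energy Y < energy X"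
      using swap_decreases_energy less.prems by blast
    then have tab: "is_table R C Y" by (simp add: swap_def)
    then have "energy Y \<ge> 0"
      unfolding energy_def by (intro sum_nonneg mult_nonneg_nonneg is_table_nonneg[OF tab]) auto
    with Y(2) less.hyps[OF _ tab] obtain W where "(swap R C S)\<^sup>*\<^sup>* Y W" "canonical W"
      by (auto simp: nat_less_eq_zless)
    with Y(1) show ?thesis
      by (meson converse_rtranclp_into_rtranclp)
  qed auto
qed

section \<open>Uniqueness of the canonical table in a fiber\<close>

lemma sum_eq_less_imp_greater:
  fixes f g :: "'a \<Rightarrow> int"
  assumes "finite A" "sum f A = sum g A" "a \<in> A" "f a < g a"
  obtains b where "b \<in> A" "g b < f b"
proof -
  have "\<exists>b\<in>A. g b < f b"
  proof (rule ccontr)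
    assume "\<not> ?thesis"
    then have "sum f A < sum g A"
      using assms by (intro sum_strict_mono_ex1) force+
    with assms(2) show False by simp
  qed
  with that show thesis by blast
qed

text \<open>On the unrolled circle each column occurs twice, reached directly (\<open>t\<close>
  true) or after wrapping (\<open>t\<close> false); this is the column sum of one copy.\<close>

definition type_sum :: "bool \<Rightarrow> array \<Rightarrow> nat \<Rightarrow> int" where
  "type_sum t X j = (\<Sum>i | i \<in> {1..R} \<and> ((i, j) \<in> S \<longleftrightarrow> t). X (i, j))"

lemma col_sum_type_sum: "col_sum R X j = type_sum True X j + type_sum False X j"
proof -
  have "sum (\<lambda>i. X (i, j)) {1..R} =
    sum (\<lambda>i. X (i, j)) ({i. i \<in> {1..R} \<and> (i, j) \<in> S} \<union> {i. i \<in> {1..R} \<and> (i, j) \<notin> S})"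
    by (rule sum.cong) auto
  also have "\<dots> = type_sum True X j + type_sum False X j"
    unfolding type_sum_def by (subst sum.union_disjoint) auto
  finally show ?thesis by (simp add: col_sum_def)
qed

lemma sum_type_sum_True: "(\<Sum>j=1..C. type_sum True X j) = sum X S"
proof -
  have "(\<Sum>j=1..C. type_sum True X j) =
      sum (\<lambda>q. X (snd q, fst q)) (SIGMA j:{1..C}. {i. i \<in> {1..R} \<and> (i, j) \<in> S})"
    unfolding type_sum_def by (simp add: sum.Sigma case_prod_beta)
  also have "\<dots> = sum X S"
    using S_sub by (intro sum.reindex_bij_witness[of _ prod.swap prod.swap]) (auto simp: cells_def)
  finally show ?thesis .
qed

lemma type_sum_nonneg: "is_table R C X \<Longrightarrow> 0 \<le> type_sum t X j"
  unfolding type_sum_def by (intro sum_nonneg is_table_nonneg)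

lemma type_sum_pos:
  assumes "type_sum t X j > 0"
  obtains i where "(i, j) \<in> S \<longleftrightarrow> t" "X (i, j) > 0"
proof -
  have "\<exists>i. ((i, j) \<in> S \<longleftrightarrow> t) \<and> X (i, j) > 0"
  proof (rule ccontr)
    assume "\<not> ?thesis"
    then have "type_sum t X j \<le> 0"
      unfolding type_sum_def by (intro sum_nonpos) force
    with assms show False by simp
  qed
  with that show thesis by blast
qed

text \<open>The total over wrapping cells is fixed, so a deficit of \<open>Y\<close> in column
  \<open>j\<close> is offset by a surplus in a later column \<open>k\<close>, which has a wrapping
  arc of \<open>Y\<close>. The column sum of \<open>j\<close> turns the deficit into a direct arc of
  \<open>Y\<close> ending at \<open>j\<close>. The former arc contains the latter.\<close>

lemma type_sum_fiber_False:
  assumes "is_table R C X" "canonical Y" "Y \<in> fiber R C S X" "j \<in> {1..C}"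
    and less: "type_sum False Y j < type_sum False X j"
    and min: "\<And>k. k \<in> {1..C} \<Longrightarrow> type_sum False Y k \<noteq> type_sum False X k \<Longrightarrow> v j \<le> v k"
  shows False
proof -
  have Y: "is_table R C Y" using assms(3) by (simp add: fiber_def)
  have eq: "type_sum True Y k + type_sum False Y k = type_sum True X k + type_sum False X k"
    if "k \<in> {1..C}" for k
    using that assms(3) by (simp add: fiber_def flip: col_sum_type_sum)
  then have "(\<Sum>k=1..C. type_sum True Y k + type_sum False Y k) =
    (\<Sum>k=1..C. type_sum True X k + type_sum False X k)"
    by (intro sum.cong) auto
  moreover have "sum Y S = sum X S" using assms(3) by (simp add: fiber_def)
  ultimately have "(\<Sum>k=1..C. type_sum False Y k) = (\<Sum>k=1..C. type_sum False X k)"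
    unfolding sum.distrib sum_type_sum_True by simp
  then obtain k where k: "k \<in> {1..C}" "type_sum False X k < type_sum False Y k"
    using less assms(4) by (elim sum_eq_less_imp_greater[rotated]) auto
  have "v j \<noteq> v k"
    using k less assms(4) v_inj by (auto dest: inj_onD)
  with min[of k] k have "v j < v k" by simp
  obtain i where i: "(i, k) \<notin> S" "Y (i, k) > 0"
    using k(2) type_sum_nonneg[OF assms(1), of False k] type_sum_pos[of False Y k] by force
  obtain i' where i': "(i', j) \<in> S" "Y (i', j) > 0"
    using less eq[OF assms(4)] type_sum_nonneg[OF assms(1), of True j] type_sum_pos[of True Y j]
    by force
  have "nested i k i' j"
    using i i' \<open>v j < v k\<close> by (simp add: nested_def)
  with assms(2) i i' show False by (auto simp: canonical_def)
qed

lemma finite_nonempty_least: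
  fixes f :: "'a \<Rightarrow> nat"
  assumes "A \<noteq> {}"
  obtains a where "a \<in> A" "\<And>b. b \<in> A \<Longrightarrow> f a \<le> f b"
  using assms ex_has_least_nat[of "\<lambda>a. a \<in> A" _ f] by blast

lemma fiber_sym: "is_table R C X \<Longrightarrow> Y \<in> fiber R C S X \<Longrightarrow> X \<in> fiber R C S Y"
  by (simp add: fiber_def)

text \<open>At the first column where the wrapping sums differ, one of the two tables has the
  smaller one, and \<open>type_sum_fiber_False\<close> applies with that table as \<open>Y\<close>.
  Column sums then give the direct part.\<close>

lemma type_sum_fiber:
  assumes X: "is_table R C X" "canonical X" and Y: "Y \<in> fiber R C S X" "canonical Y" and j: "j \<in> {1..C}"
  shows "type_sum t Y j = type_sum t X j"
proof -
  have tab: "is_table R C Y" using Y(1) by (simp add: fiber_def)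
  define D where "D = {k \<in> {1..C}. type_sum False Y k \<noteq> type_sum False X k}"
  have "D = {}"
  proof (rule ccontr)
    assume "D \<noteq> {}"
    then obtain k where k: "k \<in> D" "\<And>l. l \<in> D \<Longrightarrow> v k \<le> v l"
      by (rule finite_nonempty_least[of _ v]) blast
    show False
    proof (cases "type_sum False Y k < type_sum False X k")
      case True
      show False
        by (rule type_sum_fiber_False[OF X(1) Y(2,1) _ True]) (use k in \<open>auto simp: D_def\<close>)
    next
      case False
      then have less: "type_sum False X k < type_sum False Y k"
        using k(1) by (simp add: D_def)
      show False
        by (rule type_sum_fiber_False[OF tab X(2) fiber_sym[OF X(1) Y(1)] _ less])
          (use k in \<open>auto simp: D_def\<close>)
    qed
  qed
  then have "type_sum False Y j = type_sum False X j" using j by (auto simp: D_def)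
  moreover have "col_sum R Y j = col_sum R X j" using Y(1) j by (simp add: fiber_def)
  ultimately show ?thesis by (cases t) (simp_all add: col_sum_type_sum)
qed

text \<open>Row position plus unrolled column position. A cell of least key among those where two
  tables differ is thus a northwest corner: the others in its row or its unrolled column come
  later.\<close>

definition key :: "nat \<times> nat \<Rightarrow> nat" where
  "key p = u (fst p) + v (snd p) + (if p \<in> S then 0 else L)"

text \<open>
  Unroll the circle, so that column \<open>j\<close> splits into two columns, \<open>j\<close> and its successor one turn
  later. As the sums of the split columns agree, uniqueness is that of the northwest corner rule.
\<close>
lemma canonical_not_less:
  assumes "canonical Y" "Y \<in> fiber R C S X" "is_table R C X"
    and type: "\<And>k t. k \<in> {1..C} \<Longrightarrow> type_sum t Y k = type_sum t X k"
    and ran: "i \<in> {1..R}" "j \<in> {1..C}" and less: "Y (i, j) < X (i, j)"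
    and min: "\<And>k l. k \<in> {1..R} \<Longrightarrow> l \<in> {1..C} \<Longrightarrow> Y (k, l) \<noteq> X (k, l) \<Longrightarrow> key (i, j) \<le> key (k, l)"
  shows False
proof -
  have "row_sum C Y i = row_sum C X i"
    using assms(2) ran by (simp add: fiber_def)
  then obtain l where l: "l \<in> {1..C}" "X (i, l) < Y (i, l)"
    unfolding row_sum_def using less ran by (elim sum_eq_less_imp_greater[rotated]) auto
  have "j \<noteq> l" using l less by auto
  then have "v j \<noteq> v l"
    using l ran v_inj by (auto dest: inj_onD)
  have row: "v j + (if (i, j) \<in> S then 0 else L) \<le> v l + (if (i, l) \<in> S then 0 else L)"
    using min[of i l] ran l by (simp add: key_def)
  have "i \<in> {k. k \<in> {1..R} \<and> ((k, j) \<in> S \<longleftrightarrow> (i, j) \<in> S)}" using ran by simp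
  then obtain k where k: "k \<in> {1..R}" "(k, j) \<in> S \<longleftrightarrow> (i, j) \<in> S" "X (k, j) < Y (k, j)"
    using sum_eq_less_imp_greater[OF _ type[OF ran(2), of "(i, j) \<in> S", unfolded type_sum_def] _ less]
    by auto
  have "i \<noteq> k" using k less by auto
  then have "u i \<noteq> u k"
    using k ran u_inj by (auto dest: inj_onD)
  moreover have "u i \<le> u k"
    using min[of k j] ran k by (auto simp: key_def split: if_splits)
  ultimately have "u i < u k" by simp
  \<comment> \<open>The arc of \<open>(i, l)\<close> starts before and ends after that of
    \<open>(k, j)\<close>. The combination \<open>(i, j) \<notin> S\<close>,
    \<open>(i, l) \<in> S\<close> is excluded by \<open>row\<close>, since
    \<open>v l < L\<close>.\<close>
  have "nested i l k j"
    using \<open>u i < u k\<close> \<open>v j \<noteq> v l\<close> row k(2) v_less[OF l(1)] by (auto simp: nested_def split: if_splits)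
  moreover have "Y (i, l) > 0" "Y (k, j) > 0"
    using l k is_table_nonneg[OF assms(3)] by (meson le_less_trans)+
  ultimately show False
    using assms(1) by (auto simp: canonical_def)
qed

lemma canonical_unique:
  assumes X: "is_table R C X" "canonical X" and Y: "Y \<in> fiber R C S X" "canonical Y"
  shows "Y = X"
proof (rule ccontr)
  assume "Y \<noteq> X"
  have tab: "is_table R C Y" using Y(1) by (simp add: fiber_def)
  define D where "D = {p \<in> cells R C. Y p \<noteq> X p}"
  have "Y p = X p" if "p \<notin> D" for p
    using that X(1) tab by (cases "p \<in> cells R C") (simp_all add: D_def is_table_def is_array_def del: split_paired_All)
  with \<open>Y \<noteq> X\<close> have "D \<noteq> {}" by auto
  then obtain p where p: "p \<in> D" "\<And>q. q \<in> D \<Longrightarrow> key p \<le> key q"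
    by (rule finite_nonempty_least[of _ key]) blast
  obtain i j where ij: "p = (i, j)" by (cases p)
  note type = type_sum_fiber[OF X Y]
  show False
  proof (cases "Y p < X p")
    case True
    show False
      by (rule canonical_not_less[OF Y(2,1) X(1) type, where i = i and j = j])
        (use p True in \<open>auto simp: D_def cells_def ij\<close>)
  next
    case False
    show False
      by (rule canonical_not_less[OF X(2) fiber_sym[OF X(1) Y(1)] tab type[symmetric], where i = i and j = j])
        (use p False in \<open>auto simp: D_def cells_def ij\<close>)
  qed
qed

text \<open>Both tables descend to the same canonical table; reversing the second descent joins
  them.\<close>

lemma markov_basis: "markov_basis R C S (basic_moves R C S)"
proof (rule markov_basisI)
  fix X Y
  assume X: "is_table R C X" and Y: "Y \<in> fiber R C S X"
  then have Y': "is_table R C Y" by (simp add: fiber_def)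
  obtain V where V: "(swap R C S)\<^sup>*\<^sup>* X V" "canonical V"
    using swaps_to_canonical[OF X] by blast
  obtain W where W: "(swap R C S)\<^sup>*\<^sup>* Y W" "canonical W"
    using swaps_to_canonical[OF Y'] by blast
  have VX: "V \<in> fiber R C S X"
    using swaps_fiber[OF V(1), of X] X by (simp add: fiber_def)
  have WX: "W \<in> fiber R C S X"
    using swaps_fiber[OF W(1) Y] .
  have "is_table R C V" "W \<in> fiber R C S V"
    using VX WX by (simp_all add: fiber_def)
  then have "W = V" using V(2) W(2) canonical_unique by blast
  then show "(swap R C S)\<^sup>*\<^sup>* X Y"
    using V(1) swaps_sym[OF W(1)] by (meson rtranclp_trans)
qed

end

section \<open>The pattern-free sets\<close>

text \<open>This is a witness that rows \<open>i\<close> and \<open>i'\<close> are incomparable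
  under inclusion.\<close>

definition interchange :: "(nat \<times> nat) set \<Rightarrow> nat \<Rightarrow> nat \<Rightarrow> nat \<Rightarrow> nat \<Rightarrow> bool" where
  "interchange S i i' j j' \<longleftrightarrow> (i, j) \<in> S \<and> (i', j') \<in> S \<and> (i, j') \<notin> S \<and> (i', j) \<notin> S"

lemma less_mult_add_imp_le:
  fixes a b c m n :: nat
  assumes "a * n + b < a' * n + b'" "b' < n"
  shows "a \<le> a'"
proof (rule ccontr)
  assume "\<not> a \<le> a'"
  then have "Suc a' * n \<le> a * n" by (intro mult_le_mono1) simp
  with assms show False by simp
qed

lemma markov_basis_no_interchange:
  assumes S: "S \<subseteq> cells R C"
    and no: "\<And>i i' j j'. i \<in> {1..R} \<Longrightarrow> i' \<in> {1..R} \<Longrightarrow> j \<in> {1..C} \<Longrightarrow> j' \<in> {1..C} \<Longrightarrow>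
      \<not> interchange S i i' j j'"
  shows "markov_basis R C S (basic_moves R C S)"
proof -
  define a where "a i = card {j \<in> {1..C}. (i, j) \<notin> S}" for i
  define b where "b j = card {i \<in> {1..R}. (i, j) \<in> S}" for j
  have a_le: "a i \<le> C" for i
    using card_mono[of "{1..C}" "{j \<in> {1..C}. (i, j) \<notin> S}"] unfolding a_def by fastforce
  have b_le: "b j \<le> R" for j
    using card_mono[of "{1..R}" "{i \<in> {1..R}. (i, j) \<in> S}"] unfolding b_def by fastforce
  have S_ran: "i \<in> {1..R} \<and> j \<in> {1..C}" if "(i, j) \<in> S" for i j
    using that S by (auto simp: cells_def)
  have a_mono: "(i, j) \<in> S" if "i \<in> {1..R}" "i' \<in> {1..R}" "a i \<le> a i'" "(i', j) \<in> S" for i i' j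
  proof (rule ccontr)
    assume n: "(i, j) \<notin> S"
    \<comment> \<open>A column missing from row \<open>i'\<close> but present in row
      \<open>i\<close> would form an interchange with \<open>j\<close>.\<close>
    have "{j \<in> {1..C}. (i', j) \<notin> S} \<subset> {j \<in> {1..C}. (i, j) \<notin> S}"
      using that n no[of i i' _ j] S_ran unfolding interchange_def by blast
    then have "a i' < a i" unfolding a_def by (intro psubset_card_mono) auto
    with that show False by simp
  qed
  have b_mono: "(i, j') \<in> S" if "j \<in> {1..C}" "j' \<in> {1..C}" "b j \<le> b j'" "(i, j) \<in> S" for i j j'
  proof (rule ccontr)
    assume n: "(i, j') \<notin> S"
    have "{i \<in> {1..R}. (i, j') \<in> S} \<subset> {i \<in> {1..R}. (i, j) \<in> S}"
      using that n no[of i _ j j'] S_ran unfolding interchange_def by blast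
    then have "b j' < b j" unfolding b_def by (intro psubset_card_mono) auto
    with that show False by simp
  qed
  \<comment> \<open>Rows are ordered by \<open>a\<close>, columns by \<open>b\<close>, with ties
    broken by the index, which is a remainder modulo \<open>R + 1\<close> or \<open>C + 1\<close>.
    Since \<open>a i \<le> C\<close> and \<open>b j \<le> R\<close>, all positions stay below
    \<open>(R + 1) * (C + 1)\<close>.\<close>
  interpret staircase R C S "\<lambda>i. a i * (R + 1) + i" "\<lambda>j. b j * (C + 1) + j" "(R + 1) * (C + 1)"
  proof
    show "S \<subseteq> cells R C" by fact
    show "inj_on (\<lambda>i. a i * (R + 1) + i) {1..R}"
    proof (rule inj_onI)
      fix i i' assume "i \<in> {1..R}" "i' \<in> {1..R}" "a i * (R + 1) + i = a i' * (R + 1) + i'"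
      then have "i mod (R + 1) = i' mod (R + 1)"
        by (metis mod_mult_self3)
      with \<open>i \<in> {1..R}\<close> \<open>i' \<in> {1..R}\<close> show "i = i'" by simp
    qed
    show "inj_on (\<lambda>j. b j * (C + 1) + j) {1..C}"
    proof (rule inj_onI)
      fix i i' assume "i \<in> {1..C}" "i' \<in> {1..C}" "b i * (C + 1) + i = b i' * (C + 1) + i'"
      then have "i mod (C + 1) = i' mod (C + 1)"
        by (metis mod_mult_self3)
      with \<open>i \<in> {1..C}\<close> \<open>i' \<in> {1..C}\<close> show "i = i'" by simp
    qed
    show "a i * (R + 1) + i < (R + 1) * (C + 1)" if "i \<in> {1..R}" for i
      using mult_le_mono1[OF a_le[of i], of "R + 1"] that by (simp add: algebra_simps)
    show "b j * (C + 1) + j < (R + 1) * (C + 1)" if "j \<in> {1..C}" for j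
      using mult_le_mono1[OF b_le[of j], of "C + 1"] that by simp
    show "(i, j) \<in> S" if "i \<in> {1..R}" "i' \<in> {1..R}" "a i * (R + 1) + i < a i' * (R + 1) + i'" "(i', j) \<in> S"
      for i i' j
      by (rule a_mono[OF that(1,2) _ that(4)], rule less_mult_add_imp_le[OF that(3)]) (use that in auto)
    show "(i, j') \<in> S" if "j \<in> {1..C}" "j' \<in> {1..C}" "b j * (C + 1) + j < b j' * (C + 1) + j'" "(i, j) \<in> S"
      for i j j'
      by (rule b_mono[OF that(1,2) _ that(4)], rule less_mult_add_imp_le[OF that(3)]) (use that in auto)
  qed
  show ?thesis by (rule markov_basis)
qed

lemma contains_PI:
  assumes "i1 \<in> {1..R}" "i2 \<in> {1..R}" "j1 \<in> {1..C}" "j2 \<in> {1..C}" "j3 \<in> {1..C}"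
    and "i1 \<noteq> i2" "j1 \<noteq> j2" "j1 \<noteq> j3" "j2 \<noteq> j3"
    and "(i1, j1) \<in> T" "(i2, j2) \<in> T" "(i1, j2) \<notin> T" "(i2, j1) \<notin> T" "(i1, j3) \<notin> T" "(i2, j3) \<notin> T"
  shows "contains_P R C T"
  using assms unfolding contains_P_def by blast

lemma contains_PtI:
  assumes "i1 \<in> {1..R}" "i2 \<in> {1..R}" "i3 \<in> {1..R}" "j1 \<in> {1..C}" "j2 \<in> {1..C}"
    and "i1 \<noteq> i2" "i1 \<noteq> i3" "i2 \<noteq> i3" "j1 \<noteq> j2"
    and "(i1, j1) \<in> T" "(i2, j2) \<in> T" "(i1, j2) \<notin> T" "(i2, j1) \<notin> T" "(i3, j1) \<notin> T" "(i3, j2) \<notin> T"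
  shows "contains_Pt R C T"
  using assms unfolding contains_Pt_def by blast

text \<open>
  Without the patterns, an interchange on rows \<open>a\<close>, \<open>b\<close> forces these rows to be complementary,
  and any further row interchanges with one of the two.
\<close>
lemma interchange_two_blocks:
  assumes S: "S \<subseteq> cells R C"
    and no: "\<not> contains_P R C S" "\<not> contains_Pt R C S"
      "\<not> contains_P R C (cells R C - S)" "\<not> contains_Pt R C (cells R C - S)"
    and ran: "a \<in> {1..R}" "b \<in> {1..R}" "c \<in> {1..C}" "d \<in> {1..C}" and ch: "interchange S a b c d"
  obtains I J where "I \<subseteq> {1..R}" "J \<subseteq> {1..C}" "S = I \<times> J \<union> ({1..R} - I) \<times> ({1..C} - J)"
proof -
  have rows: "(i, k) \<in> S \<longleftrightarrow> (i', k) \<notin> S"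
    if "i \<in> {1..R}" "i' \<in> {1..R}" "j \<in> {1..C}" "j' \<in> {1..C}" "interchange S i i' j j'" "k \<in> {1..C}"
    for i i' j j' k
  proof (rule ccontr)
    assume "\<not> ?thesis"
    then have k: "(i, k) \<in> S \<longleftrightarrow> (i', k) \<in> S" by blast
    then have ne: "i \<noteq> i'" "j \<noteq> j'" "j \<noteq> k" "j' \<noteq> k"
      using that(5) by (auto simp: interchange_def)
    show False
    proof (cases "(i, k) \<in> S")
      case False
      have "contains_P R C S"
        by (rule contains_PI[OF that(1-4,6)]) (use that(5) k ne False in \<open>auto simp: interchange_def\<close>)
      with no show False by blast
    next
      case True
      \<comment> \<open>The complement has the same interchange with its columns exchanged, hence
        the order \<open>4,3\<close> of the facts.\<close>
      have "contains_P R C (cells R C - S)"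
        by (rule contains_PI[OF that(1,2,4,3,6)]) (use that k ne True in \<open>auto simp: interchange_def cells_def\<close>)
      with no show False by blast
    qed
  qed
  have cols: "(k, j) \<in> S \<longleftrightarrow> (k, j') \<notin> S"
    if "i \<in> {1..R}" "i' \<in> {1..R}" "j \<in> {1..C}" "j' \<in> {1..C}" "interchange S i i' j j'" "k \<in> {1..R}"
    for i i' j j' k
  proof (rule ccontr)
    assume "\<not> ?thesis"
    then have k: "(k, j) \<in> S \<longleftrightarrow> (k, j') \<in> S" by blast
    then have ne: "i \<noteq> i'" "j \<noteq> j'" "i \<noteq> k" "i' \<noteq> k"
      using that(5) by (auto simp: interchange_def)
    show False
    proof (cases "(k, j) \<in> S")
      case False
      have "contains_Pt R C S"
        by (rule contains_PtI[OF that(1,2,6,3,4)]) (use that(5) k ne False in \<open>auto simp: interchange_def\<close>)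
      with no show False by blast
    next
      case True
      have "contains_Pt R C (cells R C - S)"
        by (rule contains_PtI[OF that(1,2,6,4,3)]) (use that k ne True in \<open>auto simp: interchange_def cells_def\<close>)
      with no show False by blast
    qed
  qed
  \<comment> \<open>By \<open>cols\<close>, each row contains exactly one of the columns
    \<open>c\<close> and \<open>d\<close>. Rows in \<open>I\<close> interchange with
    \<open>b\<close> and so equal row \<open>a\<close>; the others interchange with \<open>a\<close>
    and so are its complement.\<close>
  define I where "I = {i \<in> {1..R}. (i, c) \<in> S}"
  define J where "J = {j \<in> {1..C}. (a, j) \<in> S}"
  have key: "(i, j) \<in> S \<longleftrightarrow> (i \<in> I \<longleftrightarrow> j \<in> J)" if "i \<in> {1..R}" "j \<in> {1..C}" for i j
  proof (cases "(i, c) \<in> S")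
    case True
    then have "(i, d) \<notin> S" using cols[OF ran ch that(1)] by simp
    then have "interchange S i b c d"
      using True ch by (simp add: interchange_def)
    then have "(i, j) \<in> S \<longleftrightarrow> (a, j) \<in> S"
      using rows[OF that(1) ran(2-4) _ that(2)] rows[OF ran ch that(2)] by blast
    then show ?thesis using True that by (simp add: I_def J_def)
  next
    case False
    then have "(i, d) \<in> S" using cols[OF ran ch that(1)] by simp
    then have "interchange S a i c d"
      using False ch by (simp add: interchange_def)
    then have "(i, j) \<in> S \<longleftrightarrow> (a, j) \<notin> S"
      using rows[OF ran(1) that(1) ran(3,4) _ that(2)] by blast
    then show ?thesis using False that by (simp add: I_def J_def)
  qed
  have IJ: "I \<subseteq> {1..R}" "J \<subseteq> {1..C}"
    by (auto simp: I_def J_def)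
  have "S = I \<times> J \<union> ({1..R} - I) \<times> ({1..C} - J)"
  proof (rule set_eqI)
    fix p :: "nat \<times> nat"
    obtain i j where p: "p = (i, j)" by (cases p)
    show "p \<in> S \<longleftrightarrow> p \<in> I \<times> J \<union> ({1..R} - I) \<times> ({1..C} - J)"
    proof (cases "i \<in> {1..R} \<and> j \<in> {1..C}")
      case True
      then show ?thesis using key[of i j] by (simp add: p) blast
    next
      case False
      then have "p \<notin> S" using S by (auto simp: p cells_def)
      then show ?thesis using False IJ by (auto simp: p)
    qed
  qed
  with IJ show thesis by (rule that)
qed

section \<open>The equivalence\<close>

theorem theorem1:
  fixes R C :: nat and S :: "(nat \<times> nat) set"
  assumes "R > 0" and "C > 0"
    and "S \<noteq> {}" and "S \<subset> cells R C"
  shows "markov_basis R C S (basic_moves R C S) \<longleftrightarrow>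
    \<not> contains_P R C S \<and> \<not> contains_Pt R C S \<and>
    \<not> contains_P R C (cells R C - S) \<and> \<not> contains_Pt R C (cells R C - S)"
proof
  have S: "S \<subseteq> cells R C" using assms(4) by blast
  have comp: "cells R C - S \<subseteq> cells R C" by blast
  show "\<not> contains_P R C S \<and> \<not> contains_Pt R C S \<and>
      \<not> contains_P R C (cells R C - S) \<and> \<not> contains_Pt R C (cells R C - S)"
    if "markov_basis R C S (basic_moves R C S)"
  proof (intro conjI notI)
    note basis = that
    note comp_basis = markov_basis_complement[OF S, THEN iffD2, OF basis]
    show False if "contains_P R C S"
      using contains_P_not_markov_basis[OF S that] basis by contradiction
    show False if "contains_Pt R C S"
      using contains_Pt_not_markov_basis[OF S that] basis by contradiction
    show False if "contains_P R C (cells R C - S)"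
      using contains_P_not_markov_basis[OF comp that] comp_basis by contradiction
    show False if "contains_Pt R C (cells R C - S)"
      using contains_Pt_not_markov_basis[OF comp that] comp_basis by contradiction
  qed
  assume no: "\<not> contains_P R C S \<and> \<not> contains_Pt R C S \<and>
    \<not> contains_P R C (cells R C - S) \<and> \<not> contains_Pt R C (cells R C - S)"
  show "markov_basis R C S (basic_moves R C S)"
  proof (cases "\<exists>i\<in>{1..R}. \<exists>i'\<in>{1..R}. \<exists>j\<in>{1..C}. \<exists>j'\<in>{1..C}. interchange S i i' j j'")
    case False
    then show ?thesis
      by (intro markov_basis_no_interchange[OF S]) auto
  next
    case True
    then obtain i i' j j' where *: "i \<in> {1..R}" "i' \<in> {1..R}" "j \<in> {1..C}" "j' \<in> {1..C}"
      "interchange S i i' j j'" by blast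
    obtain I J where IJ: "I \<subseteq> {1..R}" "J \<subseteq> {1..C}"
      "S = I \<times> J \<union> ({1..R} - I) \<times> ({1..C} - J)"
      by (rule interchange_two_blocks[OF S _ _ _ _ *]) (use no in simp_all)
    \<comment> \<open>A product has no interchange: if it contains \<open>(i, j)\<close> and
      \<open>(i', j')\<close>, it also contains \<open>(i, j')\<close>.\<close>
    have "markov_basis R C (I \<times> J) (basic_moves R C (I \<times> J))"
    proof (rule markov_basis_no_interchange)
      show "I \<times> J \<subseteq> cells R C" using IJ by (auto simp: cells_def)
    qed (auto simp: interchange_def)
    then show ?thesis
      unfolding IJ(3) using markov_basis_two_blocks[OF IJ(1,2)] by (rule iffD2[rotated])
  qed
qed

end
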